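(* Every well-filtered $T_0$ space is open well-filtered.
   Context: Let $X$ be a $T_0$ space. $\mathcal O(X)$ denotes the set of all open subsets of $X$ and $\mathcal Q(X)$ the set of all compact saturated subsets of $X$ (including the empty set), where a subset is saturated if it equals the intersection of all open sets containing it. Compactness does not include the Hausdorff condition. For $A,B\subseteq X$, write $A\ll B$ ($A$ is relatively compact in $B$) if $A\subseteq B$ and every cover of $B$ by open subsets of $X$ contains a finite subfamily covering $A$. A nonempty family $\mathcal A$ of subsets of $X$ is $\ll$-filtered if for all $A_1,A_2\in\mathcal A$ there is $A_3\in\mathcal A$ with $A_3\ll A_1$ and $A_3\ll A_2$. (For $A\subseteq X$ and $Q\in\mathcal Q(X)$, $A\ll Q$ iff $A\subseteq Q$.) $X$ is well-filtered if for every $\ll$-filtered family $\mathcal K\subseteq\mathcal Q(X)$ and every $U\in\mathcal O(X)$, $\bigcap\mathcal K\subseteq U$ implies $K\subseteq U$ for some $K\in\mathcal K$. $X$ is open well-filtered if for every $\ll$-filtered family $\{U_i:i\in I\}\subseteq\mathcal O(X)$ and every $U\in\mathcal O(X)$, $\bigcap_{i\in I}U_i\subseteq U$ implies $U_{i_0}\subseteq U$ for some $i_0\in I$. *)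

theory Defs
  imports "HOL-Analysis.Abstract_Topological_Spaces"
begin

(* The guard excludes S = UNIV when topspace X is not UNIV: then no open set contains S,
   and the intersection of the empty family is UNIV. *)
definition saturatedin :: "'a topology \<Rightarrow> 'a set \<Rightarrow> bool" where
  "saturatedin X S \<longleftrightarrow> S \<subseteq> topspace X \<and> S = \<Inter>{U. openin X U \<and> S \<subseteq> U}"

definition compact_saturated_sets :: "'a topology \<Rightarrow> 'a set set" where
  "compact_saturated_sets X = {K. compactin X K \<and> saturatedin X K}"

definition relatively_compactin :: "'a topology \<Rightarrow> 'a set \<Rightarrow> 'a set \<Rightarrow> bool" where
  "relatively_compactin X A B \<longleftrightarrow>
     A \<subseteq> B \<and> B \<subseteq> topspace X \<and>
     (\<forall>\<U>. (\<forall>U\<in>\<U>. openin X U) \<and> B \<subseteq> \<Union>\<U> \<longrightarrow> (\<exists>\<F>. finite \<F> \<and> \<F> \<subseteq> \<U> \<and> A \<subseteq> \<Union>\<F>))"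

definition rc_filtered :: "'a topology \<Rightarrow> 'a set set \<Rightarrow> bool" where
  "rc_filtered X \<A> \<longleftrightarrow>
     \<A> \<noteq> {} \<and> (\<forall>A\<in>\<A>. A \<subseteq> topspace X) \<and>
     (\<forall>A1\<in>\<A>. \<forall>A2\<in>\<A>. \<exists>A3\<in>\<A>. relatively_compactin X A3 A1 \<and> relatively_compactin X A3 A2)"

definition well_filtered :: "'a topology \<Rightarrow> bool" where
  "well_filtered X \<longleftrightarrow>
     (\<forall>\<K> U. \<K> \<subseteq> compact_saturated_sets X \<and> rc_filtered X \<K> \<and> openin X U \<and> \<Inter>\<K> \<subseteq> U
        \<longrightarrow> (\<exists>K\<in>\<K>. K \<subseteq> U))"

definition open_well_filtered :: "'a topology \<Rightarrow> bool" where
  "open_well_filtered X \<longleftrightarrow>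
     (\<forall>\<V> U. (\<forall>V\<in>\<V>. openin X V) \<and> rc_filtered X \<V> \<and> openin X U \<and> \<Inter>\<V> \<subseteq> U
        \<longrightarrow> (\<exists>V\<in>\<V>. V \<subseteq> U))"

end

theory Submission
  imports Defs
begin

text \<open>First let \<open>U\<^sub>0, U\<^sub>1, \<dots>\<close> be open with \<open>U\<^sub>n\<^sub>+\<^sub>1\<close> relatively compact in \<open>U\<^sub>n\<close>, suppose that
  \<open>U \<supseteq> \<Inter>U\<^sub>n\<close> is open, and that no \<open>U\<^sub>n\<close> lies in \<open>U\<close>. By Zorn there is a maximal open
  \<open>W \<supseteq> U\<close> containing no \<open>U\<^sub>n\<close>. Pick \<open>x\<^sub>n \<in> U\<^sub>n - W\<close>. By maximality every open set not inside
  \<open>W\<close> contains almost all \<open>x\<^sub>n\<close>, so the saturations of the tails of \<open>(x\<^sub>n)\<close> are compact; their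
  intersection lies in \<open>\<Inter>U\<^sub>n \<subseteq> W\<close>, and well-filteredness puts some \<open>x\<^sub>n\<close> into \<open>W\<close>, which is absurd.

  Consequently \<open>\<Inter>U\<^sub>n\<close> is compact for every such sequence. For an arbitrary filtered family of open
  sets, these intersections, over all descending sequences drawn from the family, form a filtered
  family of compact saturated sets with the same intersection, to which well-filteredness applies.\<close>

definition saturation_of :: "'a topology \<Rightarrow> 'a set \<Rightarrow> 'a set" where
  "saturation_of X S = \<Inter>{V. openin X V \<and> S \<subseteq> V}"

lemma saturation_of_superset: "S \<subseteq> saturation_of X S"
  unfolding saturation_of_def by blast

lemma saturation_of_mono: "S \<subseteq> T \<Longrightarrow> saturation_of X S \<subseteq> saturation_of X T"
  unfolding saturation_of_def by blast

lemma saturation_of_minimal: "openin X V \<Longrightarrow> S \<subseteq> V \<Longrightarrow> saturation_of X S \<subseteq> V"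
  unfolding saturation_of_def by blast

text \<open>A set and its saturation have the same open supersets, so saturating twice changes
  nothing. If \<open>S\<close> leaves \<open>topspace X\<close>, no open set contains it and
  \<open>saturation_of X S\<close> is \<open>UNIV\<close>.\<close>

lemma saturatedin_saturation_of:
  assumes "S \<subseteq> topspace X"
  shows "saturatedin X (saturation_of X S)"
proof -
  have "saturation_of X S \<subseteq> topspace X"
    using assms by (simp add: saturation_of_minimal)
  moreover have "{V. openin X V \<and> saturation_of X S \<subseteq> V} = {V. openin X V \<and> S \<subseteq> V}"
    using saturation_of_minimal[of X _ S] saturation_of_superset[of S X] by blast
  ultimately show ?thesis
    unfolding saturatedin_def by (simp add: saturation_of_def)
qed

lemma compactin_saturation_of:
  assumes "compactin X S"
  shows "compactin X (saturation_of X S)"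
  unfolding compactin_def
proof (intro conjI allI impI)
  show "saturation_of X S \<subseteq> topspace X"
    using assms by (simp add: compactin_subset_topspace saturation_of_minimal)
next
  fix \<U> assume \<U>: "Ball \<U> (openin X) \<and> saturation_of X S \<subseteq> \<Union>\<U>"
  then have "S \<subseteq> \<Union>\<U>" using saturation_of_superset[of S X] by (meson order_trans)
  with assms \<U> obtain \<F> where \<F>: "finite \<F>" "\<F> \<subseteq> \<U>" "S \<subseteq> \<Union>\<F>"
    unfolding compactin_def by meson
  have "openin X (\<Union>\<F>)" using \<F>(2) \<U> by blast
  with \<F> have "saturation_of X S \<subseteq> \<Union>\<F>" by (intro saturation_of_minimal)
  with \<F> show "\<exists>\<F>. finite \<F> \<and> \<F> \<subseteq> \<U> \<and> saturation_of X S \<subseteq> \<Union>\<F>" by blast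
qed

lemma saturatedin_Inter:
  assumes "\<V> \<noteq> {}" "\<And>V. V \<in> \<V> \<Longrightarrow> openin X V"
  shows "saturatedin X (\<Inter>\<V>)"
proof -
  have "\<Inter>\<V> \<subseteq> topspace X" using assms openin_subset by blast
  moreover have "\<Inter>{U. openin X U \<and> \<Inter>\<V> \<subseteq> U} \<subseteq> \<Inter>\<V>" using assms(2) by blast
  ultimately show ?thesis unfolding saturatedin_def by blast
qed

lemma relatively_compactin_subset: "relatively_compactin X A B \<Longrightarrow> A \<subseteq> B"
  by (simp add: relatively_compactin_def)

lemma relatively_compactinD:
  assumes "relatively_compactin X A B" "\<And>U. U \<in> \<U> \<Longrightarrow> openin X U" "B \<subseteq> \<Union>\<U>"
  obtains \<F> where "finite \<F>" "\<F> \<subseteq> \<U>" "A \<subseteq> \<Union>\<F>"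
  using assms unfolding relatively_compactin_def by meson

lemma relatively_compactin_compact:
  assumes "A \<subseteq> B" "compactin X B"
  shows "relatively_compactin X A B"
  unfolding relatively_compactin_def
proof (intro conjI allI impI)
  fix \<U> assume "(\<forall>U\<in>\<U>. openin X U) \<and> B \<subseteq> \<Union>\<U>"
  then obtain \<F> where "finite \<F>" "\<F> \<subseteq> \<U>" "B \<subseteq> \<Union>\<F>"
    using assms(2) unfolding compactin_def by meson
  with assms(1) show "\<exists>\<F>. finite \<F> \<and> \<F> \<subseteq> \<U> \<and> A \<subseteq> \<Union>\<F>" by blast
qed (use assms compactin_subset_topspace in auto)

text \<open>Between compact sets relative compactness is just inclusion, so it is enough to check
  that the family is filtered under inclusion.\<close>

lemma well_filteredD:
  assumes "well_filtered X" "\<K> \<noteq> {}"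
    and "\<And>K. K \<in> \<K> \<Longrightarrow> compactin X K" "\<And>K. K \<in> \<K> \<Longrightarrow> saturatedin X K"
    and "\<And>K L. K \<in> \<K> \<Longrightarrow> L \<in> \<K> \<Longrightarrow> \<exists>M\<in>\<K>. M \<subseteq> K \<and> M \<subseteq> L"
    and "openin X U" "\<Inter>\<K> \<subseteq> U"
  obtains K where "K \<in> \<K>" "K \<subseteq> U"
proof -
  have "rc_filtered X \<K>"
    unfolding rc_filtered_def
  proof (intro conjI ballI)
    fix K L assume "K \<in> \<K>" "L \<in> \<K>"
    then show "\<exists>M\<in>\<K>. relatively_compactin X M K \<and> relatively_compactin X M L"
      using assms(3,5) relatively_compactin_compact by meson
  qed (use assms(2,3) compactin_subset_topspace in \<open>blast+\<close>)
  moreover have "\<K> \<subseteq> compact_saturated_sets X"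
    using assms(3,4) by (auto simp: compact_saturated_sets_def)
  ultimately show thesis
    using assms(1,6,7) that unfolding well_filtered_def by meson
qed

text \<open>Zorn applies because of relative compactness: if the union of a chain contained
  \<open>V n\<close>, finitely many members, hence a single one, would contain
  \<open>V (Suc n)\<close>. The last property of \<open>W\<close> is its maximality, tested on
  \<open>W \<union> O'\<close>.\<close>

lemma maximal_open_not_containing:
  fixes V :: "nat \<Rightarrow> 'a set"
  assumes rc: "\<And>n. relatively_compactin X (V (Suc n)) (V n)"
    and U: "openin X U" "\<And>n. \<not> V n \<subseteq> U"
  obtains W where "openin X W" "U \<subseteq> W" "\<And>n. \<not> V n \<subseteq> W"
    and "\<And>O'. openin X O' \<Longrightarrow> \<not> O' \<subseteq> W \<Longrightarrow> \<exists>n. V n \<subseteq> W \<union> O'"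
proof -
  define \<A> where "\<A> = {W. openin X W \<and> U \<subseteq> W \<and> (\<forall>n. \<not> V n \<subseteq> W)}"
  have "\<exists>W\<in>\<A>. \<forall>W'\<in>\<A>. W \<subseteq> W' \<longrightarrow> W' = W"
  proof (rule subset_Zorn_nonempty)
    show "\<A> \<noteq> {}" using U by (auto simp: \<A>_def)
    fix \<C> assume C: "\<C> \<noteq> {}" "subset.chain \<A> \<C>"
    then have CA: "\<C> \<subseteq> \<A>" by (simp add: subset.chain_def)
    have "\<not> V n \<subseteq> \<Union>\<C>" for n
    proof
      assume "V n \<subseteq> \<Union>\<C>"
      moreover have "openin X W" if "W \<in> \<C>" for W using that CA by (auto simp: \<A>_def)
      ultimately obtain \<F> where \<F>: "finite \<F>" "\<F> \<subseteq> \<C>" "V (Suc n) \<subseteq> \<Union>\<F>"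
        using relatively_compactinD[OF rc] by metis
      \<comment> \<open>A nonempty finite chain contains its own union. If \<open>\<F>\<close> is
        empty, then so is \<open>V (Suc n)\<close>, and any member of the nonempty chain
        \<open>\<C>\<close> serves.\<close>
      obtain W where "W \<in> \<C>" "V (Suc n) \<subseteq> W"
      proof (cases "\<F> = {}")
        case True
        with C(1) \<F>(3) that show thesis by auto
      next
        case False
        have "subset.chain \<A> \<F>" using C(2) \<F>(2) unfolding subset.chain_def by blast
        with False \<F> that show thesis using Union_in_chain by blast
      qed
      with CA show False by (auto simp: \<A>_def)
    qed
    moreover have "openin X (\<Union>\<C>)" using CA by (auto simp: \<A>_def)
    moreover have "U \<subseteq> \<Union>\<C>" using C(1) CA unfolding \<A>_def by blast
    ultimately show "\<Union>\<C> \<in> \<A>" by (simp add: \<A>_def)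
  qed
  then obtain W where W: "W \<in> \<A>" "\<And>W'. W' \<in> \<A> \<Longrightarrow> W \<subseteq> W' \<Longrightarrow> W' = W" by blast
  have "\<exists>n. V n \<subseteq> W \<union> O'" if "openin X O'" "\<not> O' \<subseteq> W" for O'
  proof (rule ccontr)
    assume "\<not> ?thesis"
    with W(1) that have "W \<union> O' \<in> \<A>" by (auto simp: \<A>_def)
    with W(2) that(2) show False by blast
  qed
  with W(1) that show thesis by (auto simp: \<A>_def)
qed

lemma well_filtered_descending_sequence:
  fixes V :: "nat \<Rightarrow> 'a set"
  assumes wf: "well_filtered X"
    and op: "\<And>n. openin X (V n)"
    and rc: "\<And>n. relatively_compactin X (V (Suc n)) (V n)"
    and U: "openin X U" "(\<Inter>n. V n) \<subseteq> U"
  obtains n where "V n \<subseteq> U"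
proof (rule ccontr)
  assume "\<not> thesis"
  with that have "\<And>n. \<not> V n \<subseteq> U" by blast
  then obtain W where W: "openin X W" "U \<subseteq> W" "\<And>n. \<not> V n \<subseteq> W"
    and maxW: "\<And>O'. openin X O' \<Longrightarrow> \<not> O' \<subseteq> W \<Longrightarrow> \<exists>n. V n \<subseteq> W \<union> O'"
    using maximal_open_not_containing[of X V U, OF rc U(1)] by metis
  have "\<forall>n. \<exists>x. x \<in> V n \<and> x \<notin> W" using W(3) by blast
  then obtain x where x: "\<And>n. x n \<in> V n" "\<And>n. x n \<notin> W" by metis
  have anti: "V m \<subseteq> V n" if "n \<le> m" for m n
    using that by (rule lift_Suc_antimono_le[rotated]) (simp add: relatively_compactin_subset[OF rc])
  have tail: "x ` {n..} \<subseteq> V n" for n using anti x(1) by fastforce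
  define K where "K n = saturation_of X (x ` {n..})" for n
  have Kanti: "K m \<subseteq> K n" if "n \<le> m" for m n
    using that by (auto simp: K_def intro!: saturation_of_mono)
  have KV: "K n \<subseteq> V n" for n
    unfolding K_def by (intro saturation_of_minimal op tail)
  have comp: "compactin X (x ` {n..})" for n
    unfolding compactin_def
  proof (intro conjI allI impI)
    show "x ` {n..} \<subseteq> topspace X" using tail op openin_subset by blast
    fix \<U> assume \<U>: "Ball \<U> (openin X) \<and> x ` {n..} \<subseteq> \<Union>\<U>"
    \<comment> \<open>The member covering \<open>x n\<close> is not inside \<open>W\<close>, so
      together with \<open>W\<close> it covers some \<open>V N\<close>. The points from index
      \<open>N\<close> on lie in \<open>V N\<close> but not in \<open>W\<close>, hence in
      \<open>O'\<close>; only finitely many others remain to be covered.\<close>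
    then obtain O' where O': "O' \<in> \<U>" "x n \<in> O'" by auto
    with \<U> x(2) obtain N where N: "V N \<subseteq> W \<union> O'" using maxW by (metis subsetD)
    have ev: "x m \<in> O'" if "m \<ge> N" for m using anti[OF that] N x by blast
    have "finite (x ` {n..<N})" "x ` {n..<N} \<subseteq> \<Union>\<U>" using \<U> by auto
    then obtain \<F> where \<F>: "finite \<F>" "\<F> \<subseteq> \<U>" "x ` {n..<N} \<subseteq> \<Union>\<F>"
      by (rule finite_subset_Union)
    have "x m \<in> \<Union>(insert O' \<F>)" if "m \<ge> n" for m
    proof (cases "m < N")
      case True
      with that have "x m \<in> x ` {n..<N}" by simp
      with \<F>(3) show ?thesis by blast
    next
      case False
      then show ?thesis using ev[of m] by simp
    qed
    then have "x ` {n..} \<subseteq> \<Union>(insert O' \<F>)" by blast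
    then show "\<exists>\<F>. finite \<F> \<and> \<F> \<subseteq> \<U> \<and> x ` {n..} \<subseteq> \<Union>\<F>"
      using \<F>(1,2) O'(1) by (intro exI[of _ "insert O' \<F>"]) simp
  qed
  have "(\<Inter>n. K n) \<subseteq> (\<Inter>n. V n)" using KV by (intro INF_mono) auto
  with U(2) W(2) have K_W: "(\<Inter>n. K n) \<subseteq> W" by (meson order_trans)
  have K_filt: "\<exists>M\<in>range K. M \<subseteq> A \<and> M \<subseteq> B" if AB: "A \<in> range K" "B \<in> range K" for A B
  proof -
    obtain m n where "A = K m" "B = K n" using AB by blast
    then show ?thesis using Kanti[of m "max m n"] Kanti[of n "max m n"] by auto
  qed
  have K_comp: "compactin X A" and K_sat: "saturatedin X A" if "A \<in> range K" for A
    using that comp compactin_subset_topspace[OF comp]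
    by (auto simp: K_def compactin_saturation_of saturatedin_saturation_of)
  \<comment> \<open>The target is \<open>W\<close> and not \<open>U\<close>: every
    \<open>x n\<close> avoids \<open>W\<close>, which gives the contradiction.\<close>
  obtain A where "A \<in> range K" "A \<subseteq> W"
    by (rule well_filteredD[OF wf _ K_comp K_sat K_filt W(1) K_W]) auto
  then obtain n where "K n \<subseteq> W" by blast
  then have "x n \<in> W" using saturation_of_superset[of "x ` {n..}" X] by (auto simp: K_def)
  with x(2) show False by blast
qed

text \<open>The union of an open cover is an open set around the intersection, so it contains some
  \<open>V n\<close>. The cover of \<open>V n\<close> then has a finite part covering
  \<open>V (Suc n)\<close>, and with it the intersection.\<close>

lemma compactin_Inter_descending_sequence:
  fixes V :: "nat \<Rightarrow> 'a set"
  assumes wf: "well_filtered X"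
    and op: "\<And>n. openin X (V n)"
    and rc: "\<And>n. relatively_compactin X (V (Suc n)) (V n)"
  shows "compactin X (\<Inter>n. V n)"
  unfolding compactin_def
proof (intro conjI allI impI)
  show "(\<Inter>n. V n) \<subseteq> topspace X" using op openin_subset by blast
  fix \<U> assume \<U>: "Ball \<U> (openin X) \<and> (\<Inter>n. V n) \<subseteq> \<Union>\<U>"
  then have "openin X (\<Union>\<U>)" by blast
  with \<U> obtain n where "V n \<subseteq> \<Union>\<U>"
    using well_filtered_descending_sequence[of X V, OF wf op rc] by metis
  then obtain \<F> where "finite \<F>" "\<F> \<subseteq> \<U>" "V (Suc n) \<subseteq> \<Union>\<F>"
    using relatively_compactinD[OF rc] \<U> by metis
  then show "\<exists>\<F>. finite \<F> \<and> \<F> \<subseteq> \<U> \<and> (\<Inter>n. V n) \<subseteq> \<Union>\<F>" by blast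
qed

text \<open>This makes the intersections of descending sequences a filtered family. Constant
  \<open>s\<close> and \<open>t\<close> give a descending sequence below a prescribed
  member.\<close>

lemma rc_filtered_descending_sequence:
  fixes s t :: "nat \<Rightarrow> 'a set"
  assumes rc: "rc_filtered X \<V>" and st: "range s \<subseteq> \<V>" "range t \<subseteq> \<V>"
  obtains r where "range r \<subseteq> \<V>" "\<And>n. relatively_compactin X (r (Suc n)) (r n)"
    "\<And>n. r n \<subseteq> s n" "\<And>n. r n \<subseteq> t n"
proof -
  have filt: "\<exists>C\<in>\<V>. relatively_compactin X C A \<and> relatively_compactin X C B"
    if "A \<in> \<V>" "B \<in> \<V>" for A B
    using rc that unfolding rc_filtered_def by simp
  have below: "\<exists>C\<in>\<V>. C \<subseteq> s n \<and> C \<subseteq> t n" for n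
  proof -
    have "s n \<in> \<V>" "t n \<in> \<V>" using st by auto
    then show ?thesis using filt[of "s n" "t n"] relatively_compactin_subset by meson
  qed
  have "\<exists>r. \<forall>n. (r n \<in> \<V> \<and> r n \<subseteq> s n \<and> r n \<subseteq> t n) \<and> relatively_compactin X (r (Suc n)) (r n)"
  proof (rule dependent_nat_choice)
    show "\<exists>C. C \<in> \<V> \<and> C \<subseteq> s 0 \<and> C \<subseteq> t 0" using below by blast
    fix A n assume A: "A \<in> \<V> \<and> A \<subseteq> s n \<and> A \<subseteq> t n"
    obtain C where C: "C \<in> \<V>" "C \<subseteq> s (Suc n)" "C \<subseteq> t (Suc n)" using below by blast
    \<comment> \<open>Lying relatively compactly in \<open>A\<close> continues the descent; lying
      below \<open>C\<close> yields the bounds by \<open>s\<close> and \<open>t\<close> at the next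
      index.\<close>
    obtain D where D: "D \<in> \<V>" "relatively_compactin X D A" "relatively_compactin X D C"
      using filt[of A C] A C by auto
    then have "D \<subseteq> C" by (simp add: relatively_compactin_subset)
    with C D show "\<exists>D. (D \<in> \<V> \<and> D \<subseteq> s (Suc n) \<and> D \<subseteq> t (Suc n)) \<and> relatively_compactin X D A"
      by blast
  qed
  then show thesis using that by blast
qed

theorem mainTheorem1:
  fixes X :: "'a topology"
  assumes "t0_space X"
    and "well_filtered X"
  shows "open_well_filtered X"
  unfolding open_well_filtered_def
proof (intro allI impI)
  fix \<V> U
  assume "(\<forall>V\<in>\<V>. openin X V) \<and> rc_filtered X \<V> \<and> openin X U \<and> \<Inter>\<V> \<subseteq> U"
  then have op: "\<And>V. V \<in> \<V> \<Longrightarrow> openin X V" and rc: "rc_filtered X \<V>"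
    and U: "openin X U" "\<Inter>\<V> \<subseteq> U" by auto
  define S :: "(nat \<Rightarrow> 'a set) set"
    where "S = {s. range s \<subseteq> \<V> \<and> (\<forall>n. relatively_compactin X (s (Suc n)) (s n))}"
  define \<K> where "\<K> = (\<lambda>s. \<Inter>(range s)) ` S"
  have S_op: "openin X (s n)" and S_rc: "relatively_compactin X (s (Suc n)) (s n)"
    if "s \<in> S" for s n
    using that op by (auto simp: S_def)
  \<comment> \<open>The bounds need not come from \<open>S\<close>: \<open>start\<close> uses
    constant sequences, \<open>\<K>_filt\<close> uses members of \<open>S\<close>.\<close>
  have below: "\<exists>r\<in>S. \<forall>n. r n \<subseteq> s n \<and> r n \<subseteq> t n" if st: "range s \<subseteq> \<V>" "range t \<subseteq> \<V>" for s t
  proof -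
    obtain r where "range r \<subseteq> \<V>" "\<And>n. relatively_compactin X (r (Suc n)) (r n)"
      "\<And>n. r n \<subseteq> s n" "\<And>n. r n \<subseteq> t n"
      using rc_filtered_descending_sequence[OF rc st] by blast
    then have "r \<in> S" "\<forall>n. r n \<subseteq> s n \<and> r n \<subseteq> t n" by (auto simp: S_def)
    then show ?thesis by blast
  qed
  have start: "\<exists>s\<in>S. s 0 \<subseteq> V" if "V \<in> \<V>" for V
    using below[of "\<lambda>_. V" "\<lambda>_. V"] that by blast
  have "\<V> \<noteq> {}" using rc by (simp add: rc_filtered_def)
  then have \<K>_ne: "\<K> \<noteq> {}" using start by (auto simp: \<K>_def)
  have \<K>_U: "\<Inter>\<K> \<subseteq> U"
  proof -
    have "\<Inter>\<K> \<subseteq> V" if "V \<in> \<V>" for V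
      using start[OF that] by (auto simp: \<K>_def)
    with U(2) show ?thesis by blast
  qed
  have \<K>_comp: "compactin X K" and \<K>_sat: "saturatedin X K" if "K \<in> \<K>" for K
  proof -
    obtain s where s: "s \<in> S" "K = (\<Inter>n. s n)" using \<open>K \<in> \<K>\<close> by (auto simp: \<K>_def)
    show "compactin X K"
      unfolding s(2)
      by (rule compactin_Inter_descending_sequence[OF assms(2)]) (use s(1) S_op S_rc in simp_all)
    show "saturatedin X K"
      unfolding s(2) by (rule saturatedin_Inter) (use S_op[OF s(1)] in auto)
  qed
  have \<K>_filt: "\<exists>M\<in>\<K>. M \<subseteq> K \<and> M \<subseteq> L" if KL: "K \<in> \<K>" "L \<in> \<K>" for K L
  proof -
    obtain s t where st: "s \<in> S" "t \<in> S" "K = \<Inter>(range s)" "L = \<Inter>(range t)"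
      using KL by (auto simp: \<K>_def)
    have "range s \<subseteq> \<V>" "range t \<subseteq> \<V>" using st(1,2) by (simp_all add: S_def)
    from below[OF this] obtain r where r: "r \<in> S" "\<And>n. r n \<subseteq> s n" "\<And>n. r n \<subseteq> t n" by blast
    have "\<Inter>(range r) \<subseteq> K" "\<Inter>(range r) \<subseteq> L"
      unfolding st(3,4) by (rule INF_superset_mono[OF subset_refl], rule r)+
    moreover have "\<Inter>(range r) \<in> \<K>" using r(1) by (simp add: \<K>_def)
    ultimately show ?thesis by blast
  qed
  obtain K where "K \<in> \<K>" "K \<subseteq> U"
    by (rule well_filteredD[OF assms(2) \<K>_ne \<K>_comp \<K>_sat \<K>_filt U(1) \<K>_U])
  then obtain s where s: "s \<in> S" "(\<Inter>n. s n) \<subseteq> U" by (auto simp: \<K>_def)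
  \<comment> \<open>So far only an intersection of members of \<open>\<V>\<close> is known to lie in
    \<open>U\<close>; the sequential case, used once more, turns it into a single member.\<close>
  obtain n where "s n \<subseteq> U"
    by (rule well_filtered_descending_sequence[OF assms(2) S_op[OF s(1)] S_rc[OF s(1)] U(1) s(2)])
  moreover have "s n \<in> \<V>" using s(1) by (auto simp: S_def)
  ultimately show "\<exists>V\<in>\<V>. V \<subseteq> U" by blast
qed

end
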